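(* Let $q\ge1$ be an integer, $H\in(\frac12,1)$, and let $\{Z_t^{q,H},t\ge0\}$ be the Hermite process of order $q$ with self-similarity parameter $H$, considered on the interval $[0,1]$, such that $E[\sup_{0\le t\le 1}|Z_t^{q,H}|]<\infty$. Let $m=E[\sup_{0\le t\le 1}|Z_t^{q,H}|]$. Let $\Theta\subset\mathbb R$, let $\theta_0\in\Theta$ be the true parameter and let $x_0\in\mathbb R$ be the known initial value. For each $\varepsilon>0$ let $X=\{X_t,0\le t\le1\}$ be the continuous solution of $$X_t=x_0+\theta_0\int_0^tX_s\,ds+\varepsilon Z_t^{q,H},\qquad 0\le t\le 1,$$ let $P_{\theta_0}^{(\varepsilon)}$ denote the probability measure generated by $X$ when $\theta_0$ is the true parameter, and let $\hat\theta_\varepsilon$ be a minimum $L_1$-norm estimator, i.e. a $\Theta$-valued random variable with $$\int_0^1|X_t-x_0e^{\hat\theta_\varepsilon t}|\,dt=\inf_{\theta\in\Theta}\int_0^1|X_t-x_0e^{\theta t}|\,dt .$$ Then there exists a positive constant $C$ depending on $q,H$ such that for every $\delta>0$, $$P_{\theta_0}^{(\varepsilon)}\big(|\hat\theta_\varepsilon-\theta_0|>\delta\big)\le C\varepsilon .$$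
   Context: Hermite process. Let $W=\{W(h),h\in L^2(\mathbb R)\}$ be a centered Gaussian family on a probability space with $E[W(h)W(g)]=\langle h,g\rangle_{L^2(\mathbb R)}$. For a symmetric $f\in L^2(\mathbb R^q)$, $\int_{\mathbb R^q} f(\psi_1,\dots,\psi_q)\,dW_{\psi_1}\cdots dW_{\psi_q}$ denotes the multiple Wiener integral of order $q$ with respect to $W$. The Hermite process of order $q\ge1$ and self-similarity parameter $H\in(\frac12,1)$ is $$Z_t^{q,H}=c(q,H)\int_{\mathbb R^q}\Big(\int_0^t\prod_{j=1}^q (s-\psi_j)_+^{H_0-\frac32}\,ds\Big)dW_{\psi_1}\cdots dW_{\psi_q},\qquad t\ge 0,$$ where $H_0=1+\frac{H-1}{q}$, $c(q,H)=\sqrt{\dfrac{H(2H-1)}{q!\,\big(\beta(H_0-\frac12,\,2-2H_0)\big)^q}}$, and $\beta(\cdot,\cdot)$ is the Beta function. A version with continuous sample paths is used. The function $x_t(\theta)=x_0e^{\theta t}$ is the solution of the noiseless equation $dx_t/dt=\theta x_t$ with value $x_0$ at $t=0$. For $\delta>0$ put $g(\delta)=\inf_{|\theta-\theta_0|>\delta}\int_0^1|x_t(\theta)-x_t(\theta_0)|\,dt$; it is taken as given that $g(\delta)>0$ for any $\delta>0$. It is assumed that a measurable selection $\hat\theta_\varepsilon$ attaining the infimum exists.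
   Formalization: The constant C is uniform in ε but may depend on δ, θ₀, x₀ and Θ as well as on q, H (through m); a single C for every δ>0 is impossible, since δ→0 would force P(θ̂≠θ₀) ≤ Cε, which fails e.g. for q=1, θ₀=0, x₀=1, Θ=[−1,1]. *)

theory Defs
  imports "HOL-Probability.Probability"
begin

definition sq_integrable :: "'b measure \<Rightarrow> ('b \<Rightarrow> real) set" where
  "sq_integrable N = {f \<in> borel_measurable N. integrable N (\<lambda>x. (f x)\<^sup>2)}"

text \<open>Degenerate (almost surely zero) variables count as Gaussian.\<close>

definition centered_gaussian :: "'a measure \<Rightarrow> ('a \<Rightarrow> real) \<Rightarrow> bool" where
  "centered_gaussian M X \<longleftrightarrow> X \<in> borel_measurable M \<and>
     ((AE \<omega> in M. X \<omega> = 0) \<or>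
      (\<exists>\<sigma>>0. distributed M lborel X (\<lambda>x. ennreal (normal_density 0 \<sigma> x))))"

text \<open>
  The family \<open>W(h)\<close>, \<open>h \<in> L\<^sup>2(\<real>)\<close>: jointly Gaussian (every finite linear combination is
  Gaussian) with \<open>E[W(h) W(g)] = \<langle>h, g\<rangle>\<close>. It is indexed by Borel representatives of
  \<open>L\<^sup>2\<close>-classes; the covariance forces \<open>W(h) = W(g)\<close> almost surely if \<open>h = g\<close> almost
  everywhere.
\<close>

definition isonormal_gaussian :: "'a measure \<Rightarrow> ((real \<Rightarrow> real) \<Rightarrow> 'a \<Rightarrow> real) \<Rightarrow> bool" where
  "isonormal_gaussian M W \<longleftrightarrow>
     (\<forall>F a. finite F \<longrightarrow> F \<subseteq> sq_integrable lborel \<longrightarrow>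
        centered_gaussian M (\<lambda>\<omega>. \<Sum>h\<in>F. a h * W h \<omega>)) \<and>
     (\<forall>h\<in>sq_integrable lborel. \<forall>g\<in>sq_integrable lborel.
        (LINT \<omega>|M. W h \<omega> * W g \<omega>) = (LINT x|lborel. h x * g x))"

text \<open>
  Ito's construction of the multiple Wiener integral. Points of \<open>\<real>\<^sup>q\<close> are functions on
  \<open>{..<q}\<close>. An elementary function is a linear combination, with coefficients \<open>a i\<close>, of
  indicators of boxes \<open>A (i 0) \<times> \<dots> \<times> A (i (q - 1))\<close> built from pairwise disjoint sets of
  finite measure, where \<open>a\<close> vanishes on every multi-index with a repeated entry.
\<close>

definition elementary_data ::
    "nat \<Rightarrow> nat \<Rightarrow> (nat \<Rightarrow> real set) \<Rightarrow> ((nat \<Rightarrow> nat) \<Rightarrow> real) \<Rightarrow> bool" where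
  "elementary_data q n A a \<longleftrightarrow>
     (\<forall>k<n. A k \<in> sets lborel \<and> emeasure lborel (A k) < \<infinity>) \<and>
     disjoint_family_on A {..<n} \<and>
     (\<forall>i \<in> {..<q} \<rightarrow>\<^sub>E {..<n}. \<not> inj_on i {..<q} \<longrightarrow> a i = 0)"

definition elementary_fun ::
    "nat \<Rightarrow> nat \<Rightarrow> (nat \<Rightarrow> real set) \<Rightarrow> ((nat \<Rightarrow> nat) \<Rightarrow> real) \<Rightarrow> (nat \<Rightarrow> real) \<Rightarrow> real" where
  "elementary_fun q n A a \<psi> =
     (\<Sum>i \<in> {..<q} \<rightarrow>\<^sub>E {..<n}. a i * (\<Prod>j<q. indicator (A (i j)) (\<psi> j)))"

definition elementary_integral ::
    "((real \<Rightarrow> real) \<Rightarrow> 'a \<Rightarrow> real) \<Rightarrow>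
     nat \<Rightarrow> nat \<Rightarrow> (nat \<Rightarrow> real set) \<Rightarrow> ((nat \<Rightarrow> nat) \<Rightarrow> real) \<Rightarrow> 'a \<Rightarrow> real" where
  "elementary_integral W q n A a \<omega> =
     (\<Sum>i \<in> {..<q} \<rightarrow>\<^sub>E {..<n}. a i * (\<Prod>j<q. W (indicator (A (i j))) \<omega>))"

text \<open>
  \<open>Y\<close> is (a version of) the order-\<open>q\<close> multiple Wiener integral of \<open>f\<close>: the \<open>L\<^sup>2\<close>-limit of the
  elementary integrals along elementary functions converging to \<open>f\<close> in \<open>L\<^sup>2(\<real>\<^sup>q)\<close>. This
  determines \<open>Y\<close> up to almost sure equality.
\<close>

definition has_multiple_wiener_integral ::
    "'a measure \<Rightarrow> ((real \<Rightarrow> real) \<Rightarrow> 'a \<Rightarrow> real) \<Rightarrow> nat \<Rightarrow>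
     ((nat \<Rightarrow> real) \<Rightarrow> real) \<Rightarrow> ('a \<Rightarrow> real) \<Rightarrow> bool" where
  "has_multiple_wiener_integral M W q f Y \<longleftrightarrow>
     f \<in> sq_integrable (Pi\<^sub>M {..<q} (\<lambda>_. lborel)) \<and> Y \<in> sq_integrable M \<and>
     (\<exists>n A a. (\<forall>k. elementary_data q (n k) (A k) (a k)) \<and>
        (\<lambda>k. LINT \<psi>|Pi\<^sub>M {..<q} (\<lambda>_. lborel).
           (f \<psi> - elementary_fun q (n k) (A k) (a k) \<psi>)\<^sup>2) \<longlonglongrightarrow> 0 \<and>
        (\<lambda>k. LINT \<omega>|M.
           (Y \<omega> - elementary_integral W q (n k) (A k) (a k) \<omega>)\<^sup>2) \<longlonglongrightarrow> 0)"

definition hermite_H0 :: "nat \<Rightarrow> real \<Rightarrow> real" where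
  "hermite_H0 q H = 1 + (H - 1) / real q"

definition hermite_const :: "nat \<Rightarrow> real \<Rightarrow> real" where
  "hermite_const q H =
     sqrt (H * (2 * H - 1) /
       (fact q * (Beta (hermite_H0 q H - 1/2) (2 - 2 * hermite_H0 q H)) ^ q))"

text \<open>
  Since \<open>0 powr a = 0\<close>, the factor \<open>max 0 x powr a\<close> is \<open>x\<^sup>a\<close> for \<open>x > 0\<close> and \<open>0\<close> otherwise.
\<close>

definition hermite_kernel :: "nat \<Rightarrow> real \<Rightarrow> real \<Rightarrow> (nat \<Rightarrow> real) \<Rightarrow> real" where
  "hermite_kernel q H t \<psi> =
     (LBINT s:{0..t}. (\<Prod>j<q. max 0 (s - \<psi> j) powr (hermite_H0 q H - 3/2)))"

definition hermite_process ::
    "'a measure \<Rightarrow> ((real \<Rightarrow> real) \<Rightarrow> 'a \<Rightarrow> real) \<Rightarrow> nat \<Rightarrow> real \<Rightarrow> (real \<Rightarrow> 'a \<Rightarrow> real) \<Rightarrow> bool" where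
  "hermite_process M W q H Z \<longleftrightarrow>
     (\<forall>t\<ge>0. Z t \<in> borel_measurable M \<and>
        (\<exists>Y. has_multiple_wiener_integral M W q (hermite_kernel q H t) Y \<and>
             (AE \<omega> in M. Z t \<omega> = hermite_const q H * Y \<omega>))) \<and>
     (\<forall>\<omega>\<in>space M. continuous_on {0..} (\<lambda>t. Z t \<omega>))"

definition continuous_solution ::
    "'a measure \<Rightarrow> (real \<Rightarrow> 'a \<Rightarrow> real) \<Rightarrow> real \<Rightarrow> real \<Rightarrow> real \<Rightarrow> (real \<Rightarrow> 'a \<Rightarrow> real) \<Rightarrow> bool" where
  "continuous_solution M Z x\<^sub>0 \<theta>\<^sub>0 \<epsilon> X \<longleftrightarrow>
     (\<forall>t\<in>{0..1}. X t \<in> borel_measurable M) \<and>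
     (\<forall>\<omega>\<in>space M. continuous_on {0..1} (\<lambda>t. X t \<omega>) \<and>
        (\<forall>t\<in>{0..1}. X t \<omega> = x\<^sub>0 + \<theta>\<^sub>0 * (LBINT s:{0..t}. X s \<omega>) + \<epsilon> * Z t \<omega>))"

text \<open>
  The path space \<open>C[0,1]\<close> with the \<open>\<sigma>\<close>-algebra of the coordinate maps (its Borel
  \<open>\<sigma>\<close>-algebra), and the probability measure generated on it by a continuous process.
\<close>

definition path_space :: "(real \<Rightarrow> real) measure" where
  "path_space = restrict_space (Pi\<^sub>M {0..1} (\<lambda>_. borel)) {w. continuous_on {0..1} w}"

definition path_law :: "'a measure \<Rightarrow> (real \<Rightarrow> 'a \<Rightarrow> real) \<Rightarrow> (real \<Rightarrow> real) measure" where
  "path_law M X = distr M path_space (\<lambda>\<omega>. \<lambda>t\<in>{0..1}. X t \<omega>)"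

definition noiseless :: "real \<Rightarrow> real \<Rightarrow> real \<Rightarrow> real" where
  "noiseless x\<^sub>0 \<theta> t = x\<^sub>0 * exp (\<theta> * t)"

definition L1_dist :: "(real \<Rightarrow> real) \<Rightarrow> (real \<Rightarrow> real) \<Rightarrow> real" where
  "L1_dist u v = (LBINT t:{0..1}. \<bar>u t - v t\<bar>)"

definition separation :: "real \<Rightarrow> real \<Rightarrow> real \<Rightarrow> real" where
  "separation x\<^sub>0 \<theta>\<^sub>0 \<delta> =
     (INF \<theta>\<in>{\<theta>. \<bar>\<theta> - \<theta>\<^sub>0\<bar> > \<delta>}. L1_dist (noiseless x\<^sub>0 \<theta>) (noiseless x\<^sub>0 \<theta>\<^sub>0))"

text \<open>
  An estimator is a measurable functional of the observed path. The infimum need only be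
  attained almost surely under the law \<open>P\<close> of the observation: for unbounded \<open>\<Theta>\<close> there are
  paths in \<open>C[0,1]\<close> for which it is not attained at all.
\<close>

definition minimum_L1_estimator ::
    "(real \<Rightarrow> real) measure \<Rightarrow> real set \<Rightarrow> real \<Rightarrow> ((real \<Rightarrow> real) \<Rightarrow> real) \<Rightarrow> bool" where
  "minimum_L1_estimator P \<Theta> x\<^sub>0 est \<longleftrightarrow>
     est \<in> borel_measurable path_space \<and>
     (\<forall>w\<in>space path_space. est w \<in> \<Theta>) \<and>
     (AE w in P. L1_dist w (noiseless x\<^sub>0 (est w)) =
        (INF \<theta>\<in>\<Theta>. L1_dist w (noiseless x\<^sub>0 \<theta>)))"

end

theory Submission
  imports Defs
begin

text \<open>
  By Gronwall's inequality the path \<open>X\<close> stays within \<open>e\<^bsup>\<bar>\<theta>\<^sub>0\<bar>\<^esup> \<epsilon> sup \<bar>Z\<bar>\<close> of the noiseless solution for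
  \<open>\<theta>\<^sub>0\<close>. Since the estimator minimises the \<open>L\<^sub>1\<close> distance to \<open>X\<close>, its noiseless solution is
  at most twice as far in \<open>L\<^sub>1\<close> from that of \<open>\<theta>\<^sub>0\<close> as \<open>X\<close> is. An estimation error above \<open>\<delta>\<close>
  therefore forces \<open>2 e\<^bsup>\<bar>\<theta>\<^sub>0\<bar>\<^esup> \<epsilon> sup \<bar>Z\<bar> \<ge> g(\<delta>)\<close>, and Markov's inequality bounds the probability of
  this by a multiple of \<open>\<epsilon>\<close>.
\<close>

section \<open>Gronwall's inequality in integral form\<close>

lemma set_lebesgue_integral_has_real_derivative:
  fixes u :: "real \<Rightarrow> real"
  assumes "continuous_on {a..b} u" "t \<in> {a..b}"
  shows "((\<lambda>t. LBINT s:{a..t}. u s) has_real_derivative u t) (at t within {a..b})"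
proof -
  have eq: "(LBINT s:{a..r}. u s) = integral {a..r} u" if "r \<in> {a..b}" for r
    using that assms(1)
    by (intro set_borel_integral_eq_integral(2) borel_integrable_atLeastAtMost')
       (auto intro: continuous_on_subset)
  have "((\<lambda>r. integral {a..r} u) has_real_derivative u t) (at t within {a..b})"
    by (rule integral_has_real_derivative[OF assms])
  then show ?thesis
    by (rule has_field_derivative_transform_within[OF _ zero_less_one assms(2)]) (simp add: eq)
qed

text \<open>With the integrating factor \<open>exp (- k * t)\<close>, the right-hand side of the
  assumed inequality becomes a nonincreasing function, called \<open>\<phi>\<close> below: its
  derivative is a nonnegative multiple of the slack \<open>v t - (a + k * u t)\<close>, which the
  assumption makes nonpositive. Its initial value is \<open>a\<close>.\<close>

lemma gronwall_const:
  fixes v :: "real \<Rightarrow> real"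
  assumes cont: "continuous_on {0..b} v" and "k \<ge> 0"
    and le: "\<And>t. t \<in> {0..b} \<Longrightarrow> v t \<le> a + k * (LBINT s:{0..t}. v s)"
    and t: "t \<in> {0..b}"
  shows "v t \<le> a * exp (k * t)"
proof -
  define u where "u t = (LBINT s:{0..t}. v s)" for t
  define \<phi> where "\<phi> t = exp (- k * t) * (a + k * u t)" for t
  have u: "(u has_real_derivative v t) (at t within {0..b})" if "t \<in> {0..b}" for t
    unfolding u_def using set_lebesgue_integral_has_real_derivative[OF cont that] .
  have \<phi>: "(\<phi> has_real_derivative k * exp (- k * t) * (v t - (a + k * u t))) (at t within {0..b})"
    if "t \<in> {0..b}" for t
    unfolding \<phi>_def
    by (rule derivative_eq_intros u[OF that] refl)+ (simp add: algebra_simps)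
  have "\<phi> t \<le> \<phi> 0"
  proof (rule DERIV_nonpos_imp_decreasing_open[where f = \<phi>])
    show "\<exists>y. (\<phi> has_real_derivative y) (at s) \<and> y \<le> 0" if "0 < s" "s < t" for s
    proof (intro exI conjI)
      \<comment> \<open>At interior points the derivative within the interval is an ordinary
        two-sided one; the endpoints are covered by continuity.\<close>
      show "(\<phi> has_real_derivative k * exp (- k * s) * (v s - (a + k * u s))) (at s)"
        using \<phi>[of s] that t by (simp add: at_within_Icc_at)
      show "k * exp (- k * s) * (v s - (a + k * u s)) \<le> 0"
        using le[of s] that t \<open>k \<ge> 0\<close> by (intro mult_nonneg_nonpos) (auto simp: u_def)
    qed
    have "continuous_on {0..b} \<phi>"
      using \<phi> by (rule DERIV_continuous_on)
    then show "continuous_on {0..t} \<phi>"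
      by (rule continuous_on_subset) (use t in auto)
  qed (use t in auto)
  moreover have "u 0 = 0"
    using set_borel_integral_eq_integral(2)[OF borel_integrable_atLeastAtMost'[of 0 0 v]]
    by (simp add: u_def)
  ultimately have "\<phi> t \<le> a" by (simp add: \<phi>_def)
  then have "a + k * u t \<le> a * exp (k * t)"
    by (simp add: \<phi>_def exp_minus field_simps)
  with le[OF t] show ?thesis by (simp add: u_def)
qed

section \<open>The L1 distance on the unit interval\<close>

lemma L1_dist_commute: "L1_dist u v = L1_dist v u"
  by (simp add: L1_dist_def abs_minus_commute)

lemma L1_dist_nonneg: "L1_dist u v \<ge> 0"
  by (simp add: L1_dist_def set_lebesgue_integral_def)

lemma L1_dist_triangle:
  assumes "continuous_on {0..1} u" "continuous_on {0..1} v" "continuous_on {0..1} w"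
  shows "L1_dist u w \<le> L1_dist u v + L1_dist v w"
proof -
  have "L1_dist u v + L1_dist v w = (LBINT t:{0..1}. \<bar>u t - v t\<bar> + \<bar>v t - w t\<bar>)"
    unfolding L1_dist_def
    by (rule set_integral_add(2)[symmetric])
       (intro borel_integrable_atLeastAtMost' continuous_intros assms)+
  then show ?thesis
    unfolding L1_dist_def
    by (simp, intro set_integral_mono borel_integrable_atLeastAtMost' continuous_intros assms) auto
qed

lemma L1_dist_le:
  assumes "continuous_on {0..1} u" "continuous_on {0..1} v"
    and "\<And>t. t \<in> {0..1} \<Longrightarrow> \<bar>u t - v t\<bar> \<le> c"
  shows "L1_dist u v \<le> c"
proof -
  have "L1_dist u v \<le> (LBINT t:{0..1::real}. c)"
    unfolding L1_dist_def
    by (intro set_integral_mono borel_integrable_atLeastAtMost' continuous_intros assms)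
  then show ?thesis by (simp add: set_lebesgue_integral_def)
qed

section \<open>The noiseless equation and its perturbation\<close>

lemma continuous_on_noiseless: "continuous_on S (noiseless x\<^sub>0 \<theta>)"
  unfolding noiseless_def by (intro continuous_intros)

text \<open>The differential equation in integral form, ready to be subtracted from the equation of
  the perturbed path.\<close>

lemma noiseless_integral_equation:
  assumes "t \<ge> 0"
  shows "noiseless x\<^sub>0 \<theta> t = x\<^sub>0 + \<theta> * (LBINT s:{0..t}. noiseless x\<^sub>0 \<theta> s)"
proof -
  have "((\<lambda>s. \<theta> * noiseless x\<^sub>0 \<theta> s) has_integral (noiseless x\<^sub>0 \<theta> t - noiseless x\<^sub>0 \<theta> 0)) {0..t}"
    using assms
    by (intro fundamental_theorem_of_calculus)
       (auto simp: noiseless_def has_real_derivative_iff_has_vector_derivative[symmetric]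
          intro!: derivative_eq_intros)
  then have "noiseless x\<^sub>0 \<theta> t - noiseless x\<^sub>0 \<theta> 0 = \<theta> * integral {0..t} (noiseless x\<^sub>0 \<theta>)"
    by (metis integral_unique integral_mult_right)
  moreover have "(LBINT s:{0..t}. noiseless x\<^sub>0 \<theta> s) = integral {0..t} (noiseless x\<^sub>0 \<theta>)"
    by (intro set_borel_integral_eq_integral(2) borel_integrable_atLeastAtMost'
        continuous_on_noiseless)
  moreover have "noiseless x\<^sub>0 \<theta> 0 = x\<^sub>0"
    by (simp add: noiseless_def)
  ultimately show ?thesis by simp
qed

text \<open>The initial values cancel in the difference \<open>d\<close>, which satisfies the linear
  equation driven by \<open>z\<close> alone. Taking absolute values puts it in the form required by
  \<open>gronwall_const\<close>, applied to the absolute value of \<open>d\<close> with rate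
  \<open>\<bar>\<theta>\<bar>\<close>.\<close>

lemma perturbed_linear_equation_bound:
  fixes x z :: "real \<Rightarrow> real"
  assumes x: "continuous_on {0..1} x"
    and eq: "\<And>t. t \<in> {0..1} \<Longrightarrow> x t = x\<^sub>0 + \<theta> * (LBINT s:{0..t}. x s) + z t"
    and z: "\<And>t. t \<in> {0..1} \<Longrightarrow> \<bar>z t\<bar> \<le> a"
    and t: "t \<in> {0..1}"
  shows "\<bar>x t - noiseless x\<^sub>0 \<theta> t\<bar> \<le> exp \<bar>\<theta>\<bar> * a"
proof -
  define d where "d t = x t - noiseless x\<^sub>0 \<theta> t" for t
  have d: "continuous_on {0..1} d"
    unfolding d_def by (intro continuous_intros x continuous_on_noiseless)
  have "\<bar>d t\<bar> \<le> a + \<bar>\<theta>\<bar> * (LBINT s:{0..t}. \<bar>d s\<bar>)" if t: "t \<in> {0..1}" for t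
  proof -
    have int: "set_integrable lborel {0..t} x" "set_integrable lborel {0..t} d"
      using t by (auto intro!: borel_integrable_atLeastAtMost' intro: continuous_on_subset x d)
    have "(LBINT s:{0..t}. d s) = (LBINT s:{0..t}. x s) - (LBINT s:{0..t}. noiseless x\<^sub>0 \<theta> s)"
      unfolding d_def
      by (intro set_integral_diff int borel_integrable_atLeastAtMost' continuous_on_noiseless)
    then have "d t = \<theta> * (LBINT s:{0..t}. d s) + z t"
      using eq[OF t] noiseless_integral_equation[of t x\<^sub>0 \<theta>] t
      by (simp add: d_def[of t] right_diff_distrib)
    then have "\<bar>d t\<bar> \<le> \<bar>\<theta>\<bar> * \<bar>LBINT s:{0..t}. d s\<bar> + \<bar>z t\<bar>"
      by (metis abs_mult abs_triangle_ineq)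
    moreover have "\<bar>LBINT s:{0..t}. d s\<bar> \<le> (LBINT s:{0..t}. \<bar>d s\<bar>)"
      using set_integral_norm_bound[OF int(2)] by simp
    ultimately show ?thesis
      using z[OF t] by (smt (verit) mult_left_mono abs_ge_zero)
  qed
  from gronwall_const[OF _ _ this t] have "\<bar>d t\<bar> \<le> a * exp (\<bar>\<theta>\<bar> * t)"
    using d by (simp add: continuous_on_rabs)
  \<comment> \<open>Here \<open>t \<le> 1\<close> enters; \<open>a\<close> is nonnegative because it
    bounds an absolute value.\<close>
  also have "\<dots> \<le> a * exp \<bar>\<theta>\<bar>"
    using t z[OF t] by (intro mult_left_mono) (auto intro: mult_left_le)
  finally show ?thesis by (simp add: d_def mult.commute)
qed

section \<open>Observed paths and minimum distance estimation\<close>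

lemma continuous_on_restrict_iff: "continuous_on S (restrict f S) \<longleftrightarrow> continuous_on S f"
  by (rule continuous_on_cong) auto

text \<open>Allows probabilities and almost sure statements under \<open>path_law\<close> to be
  pulled back to the underlying space.\<close>

lemma path_measurable:
  assumes "continuous_solution M Z x\<^sub>0 \<theta> \<epsilon> X"
  shows "(\<lambda>\<omega>. \<lambda>t\<in>{0..1}. X t \<omega>) \<in> measurable M path_space"
  using assms unfolding path_space_def continuous_solution_def
  by (intro measurable_restrict_space2 measurable_restrict)
     (auto simp: continuous_on_restrict_iff simp del: restrict_apply)

text \<open>A real infimum is a lower bound only over a family bounded below; nonnegativity of
  \<open>L1_dist\<close> supplies the bound 0.\<close>

lemma separation_le:
  assumes "\<bar>\<theta> - \<theta>\<^sub>0\<bar> > \<delta>"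
  shows "separation x\<^sub>0 \<theta>\<^sub>0 \<delta> \<le> L1_dist (noiseless x\<^sub>0 \<theta>) (noiseless x\<^sub>0 \<theta>\<^sub>0)"
  unfolding separation_def using assms
  by (intro cINF_lower bdd_belowI[where m = 0]) (auto simp: L1_dist_nonneg)

text \<open>Since \<open>\<theta>\<^sub>0\<close> belongs to \<open>\<Theta>\<close>, it competes in
  the minimisation, so \<open>w\<close> is no farther from the curve of the minimiser than from that
  of \<open>\<theta>\<^sub>0\<close>. The triangle inequality through \<open>w\<close> produces the
  factor 2.\<close>

lemma estimation_error_imp_large_noise:
  assumes w: "continuous_on {0..1} w" and "\<theta>\<^sub>0 \<in> \<Theta>"
    and min: "L1_dist w (noiseless x\<^sub>0 \<theta>) = (INF \<theta>\<in>\<Theta>. L1_dist w (noiseless x\<^sub>0 \<theta>))"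
    and "\<bar>\<theta> - \<theta>\<^sub>0\<bar> > \<delta>"
  shows "separation x\<^sub>0 \<theta>\<^sub>0 \<delta> \<le> 2 * L1_dist w (noiseless x\<^sub>0 \<theta>\<^sub>0)"
proof -
  have "separation x\<^sub>0 \<theta>\<^sub>0 \<delta> \<le> L1_dist (noiseless x\<^sub>0 \<theta>) (noiseless x\<^sub>0 \<theta>\<^sub>0)"
    by (rule separation_le) fact
  also have "\<dots> \<le> L1_dist (noiseless x\<^sub>0 \<theta>) w + L1_dist w (noiseless x\<^sub>0 \<theta>\<^sub>0)"
    by (intro L1_dist_triangle continuous_on_noiseless w)
  also have "L1_dist (noiseless x\<^sub>0 \<theta>) w \<le> L1_dist w (noiseless x\<^sub>0 \<theta>\<^sub>0)"
    unfolding L1_dist_commute[of _ w] min using assms(2)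
    by (intro cINF_lower bdd_belowI[where m = 0]) (auto simp: L1_dist_nonneg)
  finally show ?thesis by simp
qed

text \<open>Markov's inequality for the supremum of the noise, with the constant kept explicit in
  \<open>separation\<close> and the expected supremum.\<close>

lemma minimum_L1_estimator_error_bound:
  fixes M :: "'a measure"
  assumes "prob_space M" and "\<theta>\<^sub>0 \<in> \<Theta>" and "separation x\<^sub>0 \<theta>\<^sub>0 \<delta> > 0" and "\<epsilon> > 0"
    and Z: "\<And>\<omega>. \<omega> \<in> space M \<Longrightarrow> continuous_on {0..1} (\<lambda>t. Z t \<omega>)"
    and S: "integrable M (\<lambda>\<omega>. SUP t\<in>{0..1}. \<bar>Z t \<omega>\<bar>)"
    and X: "continuous_solution M Z x\<^sub>0 \<theta>\<^sub>0 \<epsilon> X"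
    and est: "minimum_L1_estimator (path_law M X) \<Theta> x\<^sub>0 est"
  shows "measure (path_law M X) {w \<in> space path_space. \<bar>est w - \<theta>\<^sub>0\<bar> > \<delta>}
    \<le> 2 * exp \<bar>\<theta>\<^sub>0\<bar> * \<epsilon> / separation x\<^sub>0 \<theta>\<^sub>0 \<delta> * (LINT \<omega>|M. (SUP t\<in>{0..1}. \<bar>Z t \<omega>\<bar>))"
proof -
  interpret prob_space M by fact
  define S where "S \<omega> = (SUP t\<in>{0..1::real}. \<bar>Z t \<omega>\<bar>)" for \<omega>
  define g where "g = separation x\<^sub>0 \<theta>\<^sub>0 \<delta>"
  define path where "path \<omega> = (\<lambda>t\<in>{0..1}. X t \<omega>)" for \<omega>
  have law: "path_law M X = distr M path_space path"
    unfolding path_law_def path_def[abs_def] by (rule refl)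
  have path: "path \<in> measurable M path_space"
    unfolding path_def by (rule path_measurable) (fact X)
  have Sint: "integrable M S" using S by (simp add: S_def[abs_def])
  then have [measurable]: "S \<in> borel_measurable M" by simp
  \<comment> \<open>The real \<open>SUP\<close> dominates its members only if they are bounded
    above; continuity on a compact interval ensures this.\<close>
  have Z_le: "\<bar>Z t \<omega>\<bar> \<le> S \<omega>" if "\<omega> \<in> space M" "t \<in> {0..1}" for t \<omega>
  proof -
    have "compact ((\<lambda>t. \<bar>Z t \<omega>\<bar>) ` {0..1})"
      by (intro compact_continuous_image continuous_intros Z that) auto
    then have "bdd_above ((\<lambda>t. \<bar>Z t \<omega>\<bar>) ` {0..1})"
      by (intro bounded_imp_bdd_above compact_imp_bounded)
    then show ?thesis unfolding S_def by (rule cSUP_upper[OF that(2)])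
  qed
  then have S_nonneg: "0 \<le> S \<omega>" if "\<omega> \<in> space M" for \<omega>
    using that by (metis abs_ge_zero order_trans atLeastAtMost_iff order_refl zero_le_one)
  have cont: "continuous_on {0..1} (path \<omega>)" if "\<omega> \<in> space M" for \<omega>
    using X that by (auto simp: path_def continuous_solution_def continuous_on_restrict_iff
        simp del: restrict_apply)
  have noise: "L1_dist (path \<omega>) (noiseless x\<^sub>0 \<theta>\<^sub>0) \<le> exp \<bar>\<theta>\<^sub>0\<bar> * (\<epsilon> * S \<omega>)" if \<omega>: "\<omega> \<in> space M" for \<omega>
  proof (rule L1_dist_le[OF cont[OF \<omega>] continuous_on_noiseless])
    fix t :: real assume t: "t \<in> {0..1}"
    have "\<bar>X t \<omega> - noiseless x\<^sub>0 \<theta>\<^sub>0 t\<bar> \<le> exp \<bar>\<theta>\<^sub>0\<bar> * (\<epsilon> * S \<omega>)"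
    proof (rule perturbed_linear_equation_bound[OF _ _ _ t])
      show "\<bar>\<epsilon> * Z t \<omega>\<bar> \<le> \<epsilon> * S \<omega>" if "t \<in> {0..1}" for t
        using Z_le[OF \<omega> that] \<open>\<epsilon> > 0\<close> by (simp add: abs_mult)
    qed (use X \<omega> in \<open>auto simp: continuous_solution_def\<close>)
    with t show "\<bar>path \<omega> t - noiseless x\<^sub>0 \<theta>\<^sub>0 t\<bar> \<le> exp \<bar>\<theta>\<^sub>0\<bar> * (\<epsilon> * S \<omega>)"
      by (simp add: path_def)
  qed
  have [measurable]: "est \<in> borel_measurable path_space"
    using est by (simp add: minimum_L1_estimator_def)
  \<comment> \<open>The threshold comes from solving \<open>g \<le> 2 * (exp
    \<bar>\<theta>\<^sub>0\<bar> * (\<epsilon> * S \<omega>))\<close> for \<open>S \<omega>\<close>;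
    its reciprocal carries the factor \<open>\<epsilon>\<close> of the final bound.\<close>
  define c where "c = g / (2 * exp \<bar>\<theta>\<^sub>0\<bar> * \<epsilon>)"
  have "c > 0" using assms(3,4) by (simp add: c_def g_def)
  \<comment> \<open>\<open>AE_distrD\<close> asks for measurability of \<open>path\<close> only, so
    the event defined by the infimum over \<open>\<Theta>\<close> need not be shown
    measurable.\<close>
  have "AE \<omega> in M. L1_dist (path \<omega>) (noiseless x\<^sub>0 (est (path \<omega>))) =
      (INF \<theta>\<in>\<Theta>. L1_dist (path \<omega>) (noiseless x\<^sub>0 \<theta>))"
    using est
    by (intro AE_distrD[OF path]) (simp add: minimum_L1_estimator_def law)
  then have large: "AE \<omega> in M. \<bar>est (path \<omega>) - \<theta>\<^sub>0\<bar> > \<delta> \<longrightarrow> c \<le> S \<omega>"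
    using AE_space
  proof eventually_elim
    case (elim \<omega>)
    show ?case
    proof
      assume "\<bar>est (path \<omega>) - \<theta>\<^sub>0\<bar> > \<delta>"
      from estimation_error_imp_large_noise[OF cont \<open>\<theta>\<^sub>0 \<in> \<Theta>\<close> elim(1) this] noise[of \<omega>] elim(2)
      have "g \<le> 2 * (exp \<bar>\<theta>\<^sub>0\<bar> * (\<epsilon> * S \<omega>))" by (simp add: g_def)
      then show "c \<le> S \<omega>"
        using \<open>\<epsilon> > 0\<close> by (simp add: c_def field_simps)
    qed
  qed
  have "measure (path_law M X) {w \<in> space path_space. \<bar>est w - \<theta>\<^sub>0\<bar> > \<delta>}
      = prob (path -` {w \<in> space path_space. \<bar>est w - \<theta>\<^sub>0\<bar> > \<delta>} \<inter> space M)"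
    unfolding law by (rule measure_distr[OF path]) measurable
  also have "\<dots> \<le> prob {\<omega> \<in> space M. c \<le> S \<omega>}"
    by (rule finite_measure_mono_AE) (use large in auto)
  also have "\<dots> \<le> expectation S / c"
    using \<open>c > 0\<close> S_nonneg Sint by (intro integral_Markov_inequality_measure[where A = "{}"]) auto
  finally show ?thesis
    by (simp add: c_def g_def S_def[abs_def] field_simps)
qed

text \<open>The constant obtained grows with the reciprocal of
  \<open>separation x\<^sub>0 \<theta>\<^sub>0 \<delta>\<close>, so \<open>\<delta>\<close> is fixed
  before \<open>C\<close>. Fixing \<open>m\<close> in advance as well lets one \<open>C\<close>
  serve all probability spaces and noises with expected supremum \<open>m\<close>, all
  \<open>\<epsilon>\<close> and all estimators.\<close>

theorem theorem4p1:
  fixes q :: nat and H m x\<^sub>0 \<theta>\<^sub>0 :: real and \<Theta> :: "real set"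
  assumes "q \<ge> 1" and "1/2 < H" and "H < 1"
    and "\<theta>\<^sub>0 \<in> \<Theta>"
    and "\<forall>\<delta>>0. separation x\<^sub>0 \<theta>\<^sub>0 \<delta> > 0"
  shows "\<forall>\<delta>>0. \<exists>C>0. \<forall>(M :: 'a measure) W Z.
    prob_space M \<longrightarrow>
    isonormal_gaussian M W \<longrightarrow>
    hermite_process M W q H Z \<longrightarrow>
    integrable M (\<lambda>\<omega>. SUP t\<in>{0..1}. \<bar>Z t \<omega>\<bar>) \<longrightarrow>
    m = (LINT \<omega>|M. (SUP t\<in>{0..1}. \<bar>Z t \<omega>\<bar>)) \<longrightarrow>
    (\<forall>\<epsilon>>0. \<forall>X est.
       continuous_solution M Z x\<^sub>0 \<theta>\<^sub>0 \<epsilon> X \<longrightarrow>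
       minimum_L1_estimator (path_law M X) \<Theta> x\<^sub>0 est \<longrightarrow>
       measure (path_law M X) {w \<in> space path_space. \<bar>est w - \<theta>\<^sub>0\<bar> > \<delta>} \<le> C * \<epsilon>)"
proof (intro allI impI)
  fix \<delta> :: real assume "\<delta> > 0"
  define g where "g = separation x\<^sub>0 \<theta>\<^sub>0 \<delta>"
  have "g > 0" using assms(5) \<open>\<delta> > 0\<close> by (simp add: g_def)
  \<comment> \<open>At this point \<open>m\<close> is just a real number, not yet tied to any
    process: the absolute value handles its sign, and the summand 1 keeps \<open>C\<close> positive
    even for \<open>m = 0\<close>.\<close>
  define C where "C = 2 * exp \<bar>\<theta>\<^sub>0\<bar> / g * \<bar>m\<bar> + 1"
  have "C > 0" using \<open>g > 0\<close> by (simp add: C_def add_nonneg_pos)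
  show "\<exists>C>0. \<forall>(M :: 'a measure) W Z.
    prob_space M \<longrightarrow>
    isonormal_gaussian M W \<longrightarrow>
    hermite_process M W q H Z \<longrightarrow>
    integrable M (\<lambda>\<omega>. SUP t\<in>{0..1}. \<bar>Z t \<omega>\<bar>) \<longrightarrow>
    m = (LINT \<omega>|M. (SUP t\<in>{0..1}. \<bar>Z t \<omega>\<bar>)) \<longrightarrow>
    (\<forall>\<epsilon>>0. \<forall>X est.
       continuous_solution M Z x\<^sub>0 \<theta>\<^sub>0 \<epsilon> X \<longrightarrow>
       minimum_L1_estimator (path_law M X) \<Theta> x\<^sub>0 est \<longrightarrow>
       measure (path_law M X) {w \<in> space path_space. \<bar>est w - \<theta>\<^sub>0\<bar> > \<delta>} \<le> C * \<epsilon>)"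
  proof (intro exI[of _ C] conjI allI impI)
    fix M :: "'a measure" and W Z \<epsilon> X est
    assume M: "prob_space M" and Z: "hermite_process M W q H Z"
      and S: "integrable M (\<lambda>\<omega>. SUP t\<in>{0..1}. \<bar>Z t \<omega>\<bar>)"
      and m: "m = (LINT \<omega>|M. (SUP t\<in>{0..1}. \<bar>Z t \<omega>\<bar>))"
      and \<epsilon>: "(0::real) < \<epsilon>" and X: "continuous_solution M Z x\<^sub>0 \<theta>\<^sub>0 \<epsilon> X"
      and est: "minimum_L1_estimator (path_law M X) \<Theta> x\<^sub>0 est"
    have "continuous_on {0..1} (\<lambda>t. Z t \<omega>)" if "\<omega> \<in> space M" for \<omega>
      using Z that by (auto simp: hermite_process_def intro: continuous_on_subset)
    from minimum_L1_estimator_error_bound[OF M assms(4) \<open>g > 0\<close>[unfolded g_def] \<epsilon> this S X est]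
    have "measure (path_law M X) {w \<in> space path_space. \<bar>est w - \<theta>\<^sub>0\<bar> > \<delta>}
        \<le> 2 * exp \<bar>\<theta>\<^sub>0\<bar> * \<epsilon> / g * m"
      by (simp add: m g_def)
    also have "\<dots> \<le> 2 * exp \<bar>\<theta>\<^sub>0\<bar> * \<epsilon> / g * \<bar>m\<bar>"
      using \<epsilon> \<open>g > 0\<close> by (intro mult_left_mono) auto
    also have "\<dots> \<le> C * \<epsilon>"
      using \<epsilon> by (simp add: C_def algebra_simps)
    finally show "measure (path_law M X) {w \<in> space path_space. \<bar>est w - \<theta>\<^sub>0\<bar> > \<delta>} \<le> C * \<epsilon>" .
  qed fact
qed

end
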